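(* Let $\alpha\in\mathbf C\setminus\mathbf Z$ and $\beta\in\mathbf C$. The character and supercharacter of the $U_q[\widehat{gl(1|1)}]$-module $\mathcal F_{(\alpha;\beta)}$ are $$Ch_{\mathcal F_{(\alpha;\beta)}}(q,x,y)=\frac{q^{\frac12\alpha(2\alpha-2\beta+1)}}{\prod_{n=1}^\infty(1-q^n)^3}\sum_{i\in\mathbf Z}q^{\frac12(i^2+i)}x^{-\alpha}y^{2\beta-\alpha+2i},$$ $$Sch_{\mathcal F_{(\alpha;\beta)}}(q,x,y)=\frac{q^{\frac12\alpha(2\alpha-2\beta+1)}}{\prod_{n=1}^\infty(1-q^n)^3}\sum_{i\in\mathbf Z}(-1)^{\alpha+i}q^{\frac12(i^2+i)}x^{-\alpha}y^{2\beta-\alpha+2i}.$$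
   Context: $[n]_q=\frac{q^n-q^{-n}}{q-q^{-1}}$. Bosons $a^j_n,c_n,Q_{a^j},Q_c$ ($n\in\mathbf Z$, $j=1,2$) satisfy $[a^i_n,a^j_m]=(-1)^{i+1}\delta_{ij}\delta_{m+n,0}\frac{[n]_q^2}{n}$ and $[c_n,c_m]=\delta_{n+m,0}\frac{[n]_q^2}{n}$ (for $n,m\neq 0$), $[a^i_0,Q_{a^j}]=\delta_{ij}$, $[c_0,Q_c]=1$, all other commutators zero. Put $A^1_n=a^1_n+a^2_n$, $A^2_n=\frac{q^n+q^{-n}}2(a^1_n-a^2_n)$. With $a^i_m|0\rangle=c_m|0\rangle=0$ for $m\ge0$ and $|\lambda_1,\lambda_2;\lambda_3\rangle=e^{\lambda_1Q_{a^1}+\lambda_2Q_{a^2}+\lambda_3Q_c}|0\rangle$ (so $a^i_0$ has eigenvalue $\lambda_i$ and $c_0$ has eigenvalue $\lambda_3$), let $F_{\lambda_1,\lambda_2;\lambda_3}=\mathbf C[a^1_{-n},a^2_{-n},c_{-n}\,(n\ge1)]\,|\lambda_1,\lambda_2;\lambda_3\rangle$ and $$\mathcal F_{(\alpha;\beta)}=\bigoplus_{i\in\mathbf Z}F_{\beta-\alpha+i,\,-\beta-i;\,\alpha+i}.$$ This is a level-one $U_q[\widehat{gl(1|1)}]$-module via the free boson realization, in which $h_1=A^1_0$, $h_2=A^2_0$, and $$d=-\sum_{m\ge1}\frac{m^2}{[m]_q[2m]_q}\Big\{A^1_{-m}A^2_m+A^2_{-m}A^1_m+\frac{[2m]_q}{[m]_q}c_{-m}c_m\Big\}-\frac12\{A^1_0A^2_0+c_0(c_0+1)\}.$$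 The fermion number operator is $N_f=c_0$. For a module $M$, $Ch_M(q,x,y)=\mathrm{tr}_M(q^{-d}x^{h_1}y^{h_2})$ and $Sch_M(q,x,y)=\mathrm{tr}_M((-1)^{N_f}q^{-d}x^{h_1}y^{h_2})$. Here $(-1)^{s}=e^{\sqrt{-1}\pi s}$, and the identities are between formal generalized series in (complex) powers of $q,x,y$ (equivalently for $0<|q|<1$ with branches fixed). *)

theory Defs
  imports "HOL-Analysis.Analysis" "HOL-Library.Multiset"
begin

datatype boson = A1 | A2 | C

text \<open>A Fock monomial \<open>(l, N)\<close> stands for the product of the creation operators \<open>j\<^sub>-\<^sub>n\<close>, one
  for each occurrence of \<open>(j, n)\<close> in the multiset \<open>N\<close>, applied to the highest weight vector
  \<open>|l A1, l A2; l C\<rangle>\<close>. A vector is the function of its coefficients with respect to the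
  monomials; membership in a module (\<open>module_on\<close>) imposes finite support.\<close>

type_synonym monomial = "(boson \<Rightarrow> complex) \<times> (boson \<times> nat) multiset"
type_synonym vec = "monomial \<Rightarrow> complex"

definition ket :: "monomial \<Rightarrow> vec" where
  "ket s = (\<lambda>t. if t = s then 1 else 0)"

definition weight :: "complex \<Rightarrow> complex \<Rightarrow> complex \<Rightarrow> boson \<Rightarrow> complex" where
  "weight l1 l2 l3 = (\<lambda>j. case j of A1 \<Rightarrow> l1 | A2 \<Rightarrow> l2 | C \<Rightarrow> l3)"

definition qint :: "complex \<Rightarrow> int \<Rightarrow> complex" where
  "qint q n = (q powi n - q powi (- n)) / (q - inverse q)"

definition boson_sign :: "boson \<Rightarrow> complex" where
  "boson_sign j = (case j of A1 \<Rightarrow> 1 | A2 \<Rightarrow> - 1 | C \<Rightarrow> 1)"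

text \<open>The mode \<open>n\<close> of the boson \<open>j\<close>, acting on coefficient functions: for \<open>n < 0\<close> multiplication by
  the variable \<open>j\<^sub>n\<close>, for \<open>n > 0\<close> a multiple of the derivative with respect to \<open>j\<^sub>-\<^sub>n\<close>.\<close>

definition osc :: "complex \<Rightarrow> boson \<Rightarrow> int \<Rightarrow> vec \<Rightarrow> vec" where
  "osc q j n v = (\<lambda>(l, N).
     if n = 0 then l j * v (l, N)
     else if n < 0 then
       (if (j, nat (- n)) \<in># N then v (l, N - {#(j, nat (- n))#}) else 0)
     else boson_sign j * (qint q n)\<^sup>2 / of_int n
            * of_nat (count N (j, nat n) + 1) * v (l, add_mset (j, nat n) N))"

definition exp_Q :: "(boson \<Rightarrow> complex) \<Rightarrow> vec \<Rightarrow> vec" where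
  "exp_Q m v = (\<lambda>(l, N). v (\<lambda>j. l j - m j, N))"

lemma osc_lower_raise:
  assumes "n > 0" "m > 0"
  shows "osc q i n (osc q j (- m) v) s - osc q j (- m) (osc q i n v) s =
     (if i = j \<and> m = n then boson_sign i * (qint q n)\<^sup>2 / of_int n * v s else 0)"
proof -
  obtain l N where s: "s = (l, N)" by (cases s)
  have eq: "nat n = nat m \<longleftrightarrow> n = m" using assms by auto
  show ?thesis
  proof (cases "(i, n) = (j, m)")
    case True
    then have ij: "j = i" "m = n" by auto
    show ?thesis
    proof (cases "(i, nat n) \<in># N")
      case True
      from True obtain k where k: "count N (i, nat n) = Suc k"
        by (metis count_greater_zero_iff gr0_implies_Suc)
      from assms True k show ?thesis
        unfolding s osc_def ij by (simp add: algebra_simps add_divide_distrib)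
    next
      case False
      then show ?thesis
        using assms unfolding s osc_def ij by (simp add: count_eq_zero_iff[THEN iffD2])
    qed
  next
    case False
    then have ne: "(i, nat n) \<noteq> (j, nat m)" using eq by auto
    then have "add_mset (i, nat n) N - {#(j, nat m)#} = add_mset (i, nat n) (N - {#(j, nat m)#})"
      if "(j, nat m) \<in># N" using that by simp
    then show ?thesis
      using assms False ne unfolding s osc_def by auto
  qed
qed

lemma osc_commutator:
  "osc q i n (osc q j m v) s - osc q j m (osc q i n v) s =
     (if i = j \<and> m + n = 0 \<and> n \<noteq> 0 then boson_sign i * (qint q n)\<^sup>2 / of_int n * v s else 0)"
proof -
  obtain l N where s: "s = (l, N)" by (cases s)
  have neg: "qint q (- k) = - qint q k" for k
    unfolding qint_def by (metis minus_diff_eq minus_divide_left minus_minus)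
  consider "n = 0 \<or> m = 0" | "n < 0" "m < 0" | "n > 0" "m > 0"
    | "n > 0" "m < 0" | "n < 0" "m > 0" by linarith
  then show ?thesis
  proof cases
    case 1
    then have "(if i = j \<and> m + n = 0 \<and> n \<noteq> 0
        then boson_sign i * (qint q n)\<^sup>2 / of_int n * v s else 0) = 0" by auto
    moreover have "osc q i n (osc q j m v) s = osc q j m (osc q i n v) s"
      using 1
    proof
      assume "n = 0"
      then show ?thesis by (simp add: s osc_def)
    next
      assume "m = 0"
      then show ?thesis by (simp add: s osc_def)
    qed
    ultimately show ?thesis by simp
  next
    case 2
    let ?x = "(i, nat (- n))" and ?y = "(j, nat (- m))"
    have comm: "N - {#?x#} - {#?y#} = N - {#?y#} - {#?x#}"
      by (rule diff_right_commute)
    have L: "osc q i n (osc q j m v) s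
        = (if ?x \<in># N \<and> ?y \<in># N - {#?x#} then v (l, N - {#?x#} - {#?y#}) else 0)"
      using 2 by (simp add: s osc_def)
    have R: "osc q j m (osc q i n v) s
        = (if ?y \<in># N \<and> ?x \<in># N - {#?y#} then v (l, N - {#?y#} - {#?x#}) else 0)"
      using 2 by (simp add: s osc_def)
    have "?x \<in># N \<and> ?y \<in># N - {#?x#} \<longleftrightarrow> ?y \<in># N \<and> ?x \<in># N - {#?y#}"
      by (cases "?x = ?y") (auto simp: in_diff_count)
    then show ?thesis
      unfolding L R comm using 2 by auto
  next
    case 3
    let ?x = "(i, nat n)" and ?y = "(j, nat m)"
    define c where "c k = boson_sign i * (qint q n)\<^sup>2 / of_int n * of_nat (k + 1)" for k
    define c' where "c' k = boson_sign j * (qint q m)\<^sup>2 / of_int m * of_nat (k + 1)" for k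
    have L: "osc q i n (osc q j m v) s
        = c (count N ?x) * (c' (count (add_mset ?x N) ?y) * v (l, add_mset ?y (add_mset ?x N)))"
      using 3 by (simp add: s osc_def c_def c'_def)
    have R: "osc q j m (osc q i n v) s
        = c' (count N ?y) * (c (count (add_mset ?y N) ?x) * v (l, add_mset ?y (add_mset ?x N)))"
      using 3 by (simp add: s osc_def c_def c'_def add_mset_commute[of ?x ?y])
    have "c (count N ?x) * c' (count (add_mset ?x N) ?y)
        = c' (count N ?y) * c (count (add_mset ?y N) ?x)"
    proof (cases "?x = ?y")
      case True
      then have "j = i" "m = n" using 3 by auto
      then show ?thesis by (simp add: c_def c'_def)
    next
      case False
      then show ?thesis by auto
    qed
    then show ?thesis
      unfolding L R mult.assoc[symmetric] using 3 by auto
  next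
    case 4
    then show ?thesis using osc_lower_raise[of n "- m" q i j v s] by auto
  next
    case 5
    let ?c = "boson_sign i * (qint q n)\<^sup>2 / of_int n * v s"
    have "osc q i n (osc q j m v) s - osc q j m (osc q i n v) s
        = - (osc q j m (osc q i n v) s - osc q i n (osc q j m v) s)" by simp
    also have "\<dots> = - (if j = i \<and> - n = m
        then boson_sign j * (qint q m)\<^sup>2 / of_int m * v s else 0)"
      using osc_lower_raise[of m "- n" q j i v s] 5 by simp
    also have "\<dots> = (if i = j \<and> m + n = 0 \<and> n \<noteq> 0 then ?c else 0)"
      using 5 neg[of n] by auto
    finally show ?thesis .
  qed
qed

lemma osc_zero_exp_Q:
  "osc q j 0 (exp_Q m v) s - exp_Q m (osc q j 0 v) s = m j * exp_Q m v s"
  by (cases s) (simp add: osc_def exp_Q_def algebra_simps)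

lemma ket_highest_weight: "ket (l, {#}) = exp_Q l (ket (\<lambda>j. 0, {#}))"
  by (auto simp: ket_def exp_Q_def fun_eq_iff)

lemma osc_vacuum: "n \<ge> 0 \<Longrightarrow> osc q j n (ket (\<lambda>j. 0, {#})) = (\<lambda>s. 0)"
  by (auto simp: osc_def ket_def fun_eq_iff)

lemma osc_creation_ket:
  "n \<ge> 1 \<Longrightarrow> osc q j (- int n) (ket (l, N)) = ket (l, add_mset (j, n) N)"
  by (auto simp: osc_def ket_def fun_eq_iff dest: insert_DiffM)

definition fock_basis :: "(boson \<Rightarrow> complex) \<Rightarrow> monomial set" where
  "fock_basis l = {(l, N) | N. \<forall>(j, n)\<in>#N. n \<ge> 1}"

definition module_on :: "monomial set \<Rightarrow> vec set" where
  "module_on B = {v. finite {s. v s \<noteq> 0} \<and> {s. v s \<noteq> 0} \<subseteq> B}"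

text \<open>The sum over \<open>i\<close> is direct because the weights are pairwise distinct.\<close>

definition fock_module :: "complex \<Rightarrow> complex \<Rightarrow> vec set" where
  "fock_module \<alpha> \<beta> = module_on (\<Union>i::int. fock_basis
     (weight (\<beta> - \<alpha> + of_int i) (- \<beta> - of_int i) (\<alpha> + of_int i)))"

definition bigA1 :: "complex \<Rightarrow> int \<Rightarrow> vec \<Rightarrow> vec" where
  "bigA1 q n v = (\<lambda>s. osc q A1 n v s + osc q A2 n v s)"

definition bigA2 :: "complex \<Rightarrow> int \<Rightarrow> vec \<Rightarrow> vec" where
  "bigA2 q n v = (\<lambda>s. (q powi n + q powi (- n)) / 2 * (osc q A1 n v s - osc q A2 n v s))"

definition h1 :: "complex \<Rightarrow> vec \<Rightarrow> vec" where "h1 q = bigA1 q 0"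

definition h2 :: "complex \<Rightarrow> vec \<Rightarrow> vec" where "h2 q = bigA2 q 0"

definition fermion_number :: "complex \<Rightarrow> vec \<Rightarrow> vec" where "fermion_number q = osc q C 0"

text \<open>On a given monomial only finitely many terms of the sum over the modes \<open>m\<close> are non-zero.\<close>

definition derivation :: "complex \<Rightarrow> vec \<Rightarrow> vec" where
  "derivation q v = (\<lambda>s.
     - (\<Sum>\<^sub>\<infinity>m\<in>{1::int..}. of_int m ^ 2 / (qint q m * qint q (2 * m)) *
          (bigA1 q (- m) (bigA2 q m v) s + bigA2 q (- m) (bigA1 q m v) s
            + qint q (2 * m) / qint q m * osc q C (- m) (osc q C m v) s))
     - 1 / 2 * (bigA1 q 0 (bigA2 q 0 v) s
                 + osc q C 0 (\<lambda>t. osc q C 0 v t + v t) s))"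

text \<open>The operator \<open>e\<^bsup>lD\<^esup>\<close>, the exponential series being summed coefficientwise.
  If \<open>l\<close> is a logarithm of \<open>z\<close>, this is the operator \<open>z\<^bsup>D\<^esup>\<close> for that branch.\<close>

definition exp_op :: "complex \<Rightarrow> (vec \<Rightarrow> vec) \<Rightarrow> vec \<Rightarrow> vec" where
  "exp_op l D v = (\<lambda>s. \<Sum>k. l ^ k / fact k * (D ^^ k) v s)"

text \<open>The trace on a module spanned by monomials: the absolutely convergent sum of the diagonal
  matrix coefficients.\<close>

definition has_trace :: "vec set \<Rightarrow> (vec \<Rightarrow> vec) \<Rightarrow> complex \<Rightarrow> bool" where
  "has_trace M T t \<longleftrightarrow> (\<forall>v\<in>M. T v \<in> M) \<and> ((\<lambda>s. T (ket s) s) has_sum t) {s. ket s \<in> M}"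

text \<open>The arguments \<open>lq\<close>, \<open>lx\<close>, \<open>ly\<close> are logarithms of \<open>q\<close>, \<open>x\<close>, \<open>y\<close>; they fix the branches of the
  complex powers. The same \<open>q\<close> enters the operators of the free boson realization.\<close>

definition has_Ch ::
  "vec set \<Rightarrow> complex \<Rightarrow> complex \<Rightarrow> complex \<Rightarrow> complex \<Rightarrow> bool" where
  "has_Ch M lq lx ly t \<longleftrightarrow> has_trace M
     (exp_op (- lq) (derivation (exp lq)) \<circ> exp_op lx (h1 (exp lq)) \<circ> exp_op ly (h2 (exp lq))) t"

definition has_Sch ::
  "vec set \<Rightarrow> complex \<Rightarrow> complex \<Rightarrow> complex \<Rightarrow> complex \<Rightarrow> bool" where
  "has_Sch M lq lx ly t \<longleftrightarrow> has_trace M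
     (exp_op (\<i> * of_real pi) (fermion_number (exp lq)) \<circ> exp_op (- lq) (derivation (exp lq))
        \<circ> exp_op lx (h1 (exp lq)) \<circ> exp_op ly (h2 (exp lq))) t"

definition bpow :: "complex \<Rightarrow> complex \<Rightarrow> complex" where
  "bpow l s = exp (s * l)"

end

theory Submission
  imports Defs
begin

text \<open>All operators involved are diagonal in the monomial basis. By the bosonic commutation relations the
  non-zero modes of \<open>-d\<close> count the total mode number of a monomial, while the zero modes contribute a
  quadratic function of the momentum. The trace therefore factors into a Gaussian sum over the momentum
  shifts \<open>i\<close>, which converges absolutely since \<open>|q| < 1\<close>, and the generating function of multisets of
  pairs (boson, mode), in which the three bosons give the cube of Euler's product.\<close>

section \<open>Unordered sums: products and exhaustions\<close>

no_notation Infinite_Set_Sum.abs_summable_on (infix \<open>abs'_summable'_on\<close> 50)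

text \<open>The norm of \<open>f x * g y\<close> factors, so the double family is absolutely
  summable and may be summed one variable at a time.\<close>

lemma has_sum_times_abs:
  fixes f :: "'a \<Rightarrow> 'c :: {real_normed_field, banach}" and g :: "'b \<Rightarrow> 'c"
  assumes f: "f abs_summable_on A" "(f has_sum a) A"
    and g: "g abs_summable_on B" "(g has_sum b) B"
  shows "(\<lambda>(x, y). f x * g y) abs_summable_on A \<times> B"
    and "((\<lambda>(x, y). f x * g y) has_sum a * b) (A \<times> B)"
proof -
  show abs: "(\<lambda>(x, y). f x * g y) abs_summable_on A \<times> B"
    unfolding Infinite_Sum.abs_summable_on_Sigma_iff
    using f(1) g(1)
    by (auto simp: norm_mult infsum_cmult_right infsum_nonneg
        intro!: summable_on_cmult_right summable_on_cmult_left)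
  show "((\<lambda>(x, y). f x * g y) has_sum a * b) (A \<times> B)"
  proof (rule has_sum_SigmaI)
    show "((\<lambda>y. case (x, y) of (x, y) \<Rightarrow> f x * g y) has_sum f x * b) B" for x
      using has_sum_cmult_right[OF g(2)] by simp
    show "((\<lambda>x. f x * b) has_sum a * b) A"
      by (rule has_sum_cmult_left[OF f(2)])
    show "(\<lambda>(x, y). f x * g y) summable_on A \<times> B"
      by (rule abs_summable_summable[OF abs])
  qed
qed

lemma finite_subset_incseq_UN:
  fixes S :: "nat \<Rightarrow> 'a set"
  assumes "finite F" "F \<subseteq> (\<Union>k. S k)" "incseq S"
  obtains K where "F \<subseteq> S K"
proof -
  have "\<exists>K. F \<subseteq> S K"
    using assms(1,2)
  proof (induction F rule: finite_induct)
    case empty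
    show ?case by simp
  next
    case (insert x F)
    then obtain K k where "F \<subseteq> S K" "x \<in> S k" by auto
    then have "insert x F \<subseteq> S (max K k)"
      using incseqD[OF assms(3), of K "max K k"] incseqD[OF assms(3), of k "max K k"] by auto
    then show ?case by blast
  qed
  then show thesis using that by blast
qed

text \<open>A finite set \<open>F\<close> carries all but \<open>e / 2\<close> of the sum of norms.
  Once \<open>S k\<close> contains \<open>F\<close>, the error is at most the norm tail outside
  \<open>F\<close>.\<close>

lemma infsum_tendsto_incseq:
  fixes f :: "'a \<Rightarrow> 'b :: banach"
  assumes abs: "f abs_summable_on (\<Union>k. S k)" and S: "incseq S"
  shows "(\<lambda>k. infsum f (S k)) \<longlonglongrightarrow> infsum f (\<Union>k. S k)"
proof (rule metric_LIMSEQ_I)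
  fix e :: real
  assume "e > 0"
  let ?U = "\<Union>k. S k"
  have sub: "(\<lambda>s. norm (f s)) summable_on B" if "B \<subseteq> ?U" for B
    using summable_on_subset_banach[OF abs that] .
  obtain F where F: "finite F" "F \<subseteq> ?U"
    and close: "dist (\<Sum>s\<in>F. norm (f s)) (\<Sum>\<^sub>\<infinity>s\<in>?U. norm (f s)) \<le> e / 2"
    using infsum_finite_approximation[OF abs, of "e / 2"] \<open>e > 0\<close> by auto
  obtain K where "F \<subseteq> S K"
    using finite_subset_incseq_UN[OF F S] by blast
  then have K: "F \<subseteq> S k" if "k \<ge> K" for k
    using incseqD[OF S that] by blast
  have "dist (infsum f (S k)) (infsum f ?U) < e" if k: "k \<ge> K" for k
  proof -
    have Sk: "S k \<subseteq> ?U" by auto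
    have "dist (infsum f (S k)) (infsum f ?U) = norm (infsum f (?U - S k))"
      using infsum_Diff[OF abs_summable_summable[OF abs]
          abs_summable_summable[OF sub[OF Sk]] Sk]
      by (simp add: dist_norm norm_minus_commute)
    also have "\<dots> \<le> (\<Sum>\<^sub>\<infinity>s\<in>?U - S k. norm (f s))"
      by (rule norm_infsum_bound) (rule sub, auto)
    also have "\<dots> \<le> (\<Sum>\<^sub>\<infinity>s\<in>?U - F. norm (f s))"
      by (rule infsum_mono2) (use K[OF k] in \<open>auto intro: sub\<close>)
    also have "\<dots> = (\<Sum>\<^sub>\<infinity>s\<in>?U. norm (f s)) - (\<Sum>s\<in>F. norm (f s))"
      using infsum_Diff[OF abs sub[OF F(2)] F(2)] F(1) by simp
    also have "\<dots> < e"
      using close \<open>e > 0\<close> unfolding dist_real_def by linarith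
    finally show ?thesis .
  qed
  then show "\<exists>K. \<forall>k\<ge>K. dist (infsum f (S k)) (infsum f ?U) < e"
    by blast
qed

section \<open>Generating functions of multisets\<close>

text \<open>Induction on the ground set: a multiset over \<open>insert x X\<close> is uniquely
  \<open>k\<close> copies of \<open>x\<close> plus a multiset over \<open>X\<close>, so each new
  element contributes one geometric series as a factor.\<close>

lemma has_sum_prod_mset_finite:
  fixes z :: "'a \<Rightarrow> 'b :: {real_normed_field, banach}"
  assumes "finite X" and "\<And>x. x \<in> X \<Longrightarrow> norm (z x) < 1"
  shows "(\<lambda>N. prod_mset (image_mset z N)) abs_summable_on {N. set_mset N \<subseteq> X} \<and>
    ((\<lambda>N. prod_mset (image_mset z N)) has_sum (\<Prod>x\<in>X. 1 / (1 - z x))) {N. set_mset N \<subseteq> X}"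
  using assms
proof (induction X rule: finite_induct)
  case empty
  have *: "{N :: 'a multiset. set_mset N \<subseteq> {}} = {{#}}" by auto
  show ?case unfolding * by (auto intro!: has_sum_finiteI)
next
  case (insert x X)
  let ?w = "\<lambda>N. prod_mset (image_mset z N)"
  let ?f = "\<lambda>(k, N). z x ^ k * ?w N" and ?g = "\<lambda>(k, N). replicate_mset k x + N"
  have z: "norm (z x) < 1" using insert.prems by simp
  have geom: "(\<lambda>k. z x ^ k) abs_summable_on UNIV" "((\<lambda>k. z x ^ k) has_sum 1 / (1 - z x)) UNIV"
  proof -
    have s: "summable (\<lambda>k. norm (z x ^ k))"
      using z by (simp add: norm_power summable_geometric)
    show "(\<lambda>k. z x ^ k) abs_summable_on UNIV"
      using summable_nonneg_imp_summable_on[OF s] by simp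
    show "((\<lambda>k. z x ^ k) has_sum 1 / (1 - z x)) UNIV"
      by (rule norm_summable_imp_has_sum[OF s geometric_sums[OF z]])
  qed
  have IH: "?w abs_summable_on {N. set_mset N \<subseteq> X}"
    "(?w has_sum (\<Prod>x\<in>X. 1 / (1 - z x))) {N. set_mset N \<subseteq> X}"
    using insert by auto
  note prod = has_sum_times_abs[OF geom IH]
  have bij: "bij_betw ?g (UNIV \<times> {N. set_mset N \<subseteq> X}) {N. set_mset N \<subseteq> insert x X}"
  \<comment> \<open>The inverse reads off the multiplicity of \<open>x\<close> and deletes its
    copies; it recovers the pair because \<open>x\<close> is not in \<open>X\<close>.\<close>
  proof (rule bij_betw_byWitness[where f' = "\<lambda>N. (count N x, filter_mset (\<lambda>y. y \<noteq> x) N)"])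
    have "filter_mset (\<lambda>y. y \<noteq> x) (replicate_mset k x + N) = N" "count N x = 0"
      if "set_mset N \<subseteq> X" for k N
      using that insert.hyps by (auto simp: multiset_eq_iff count_eq_zero_iff)
    then show "\<forall>p\<in>UNIV \<times> {N. set_mset N \<subseteq> X}.
        (count (?g p) x, filter_mset (\<lambda>y. y \<noteq> x) (?g p)) = p"
      by auto
    show "\<forall>N\<in>{N. set_mset N \<subseteq> insert x X}. ?g (count N x, filter_mset (\<lambda>y. y \<noteq> x) N) = N"
      by (auto simp: multiset_eq_iff)
  qed (use insert.hyps in \<open>auto split: if_splits\<close>)
  have g: "?w (?g p) = ?f p" for p
    by (cases p) simp
  show ?case
    using prod insert.hyps
      summable_on_reindex_bij_betw[OF bij, of "\<lambda>N. norm (?w N)", unfolded g, THEN iffD1]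
      has_sum_reindex_bij_betw[OF bij, of ?w, unfolded g, THEN iffD1]
    by (simp only: prod.insert simp_thms)
qed

text \<open>Passage to an infinite ground set. The uniform bound \<open>b\<close> on the products
  for the norms gives absolute summability; the value is then the limit along the exhaustion by the
  finite sets \<open>X k\<close>.\<close>

lemma has_sum_prod_mset:
  fixes z :: "'a \<Rightarrow> 'b :: {real_normed_field, banach}"
  assumes X: "incseq X" "\<And>k. finite (X k)"
    and z: "\<And>x k. x \<in> X k \<Longrightarrow> norm (z x) < 1"
    and bound: "\<And>k. (\<Prod>x\<in>X k. 1 / (1 - norm (z x))) \<le> b"
    and lim: "(\<lambda>k. \<Prod>x\<in>X k. 1 / (1 - z x)) \<longlonglongrightarrow> L"
  shows "(\<lambda>N. prod_mset (image_mset z N)) abs_summable_on {N. set_mset N \<subseteq> (\<Union>k. X k)}"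
    and "((\<lambda>N. prod_mset (image_mset z N)) has_sum L) {N. set_mset N \<subseteq> (\<Union>k. X k)}"
proof -
  let ?w = "\<lambda>N. prod_mset (image_mset z N)"
  let ?S = "\<lambda>k. {N. set_mset N \<subseteq> X k}"
  have union: "{N. set_mset N \<subseteq> (\<Union>k. X k)} = (\<Union>k. ?S k)"
  proof (intro equalityI subsetI)
    fix N assume "N \<in> {N. set_mset N \<subseteq> (\<Union>k. X k)}"
    then obtain k where "set_mset N \<subseteq> X k"
      using finite_subset_incseq_UN[OF finite_set_mset _ X(1)] by blast
    then show "N \<in> (\<Union>k. ?S k)" by blast
  qed auto
  have S: "incseq ?S"
    using X(1) by (auto simp: incseq_def)
  have norm_w: "norm (?w N) = prod_mset (image_mset (\<lambda>x. norm (z x)) N)" for N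
    by (induction N) (auto simp: norm_mult)
  show abs: "?w abs_summable_on {N. set_mset N \<subseteq> (\<Union>k. X k)}"
    unfolding union abs_summable_iff_bdd_above
  proof (rule bdd_aboveI2)
    fix F assume "F \<in> {F. F \<subseteq> (\<Union>k. ?S k) \<and> finite F}"
    then have F: "finite F" "F \<subseteq> (\<Union>k. ?S k)" by auto
    \<comment> \<open>Finitely many multisets involve finitely many elements, so a single
      \<open>X K\<close> supports them all and the finite case bounds their norm sum.\<close>
    obtain K where FK: "F \<subseteq> ?S K"
      using finite_subset_incseq_UN[OF F S] by blast
    have hs: "((\<lambda>N. norm (?w N)) has_sum (\<Prod>x\<in>X K. 1 / (1 - norm (z x)))) (?S K)"
      using has_sum_prod_mset_finite[of "X K" "\<lambda>x. norm (z x)"] X(2) z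
      by (simp add: norm_w)
    have "(\<Sum>N\<in>F. norm (?w N)) \<le> (\<Prod>x\<in>X K. 1 / (1 - norm (z x)))"
      by (rule finite_sum_le_has_sum[OF hs F(1) FK]) auto
    then show "(\<Sum>N\<in>F. norm (?w N)) \<le> b"
      using bound[of K] by linarith
  qed
  have "infsum ?w (?S k) = (\<Prod>x\<in>X k. 1 / (1 - z x))" for k
    using has_sum_prod_mset_finite[of "X k" z] X(2) z by (auto intro: infsumI)
  then have "(\<lambda>k. infsum ?w (?S k)) \<longlonglongrightarrow> L"
    using lim by simp
  then have "infsum ?w (\<Union>k. ?S k) = L"
    using infsum_tendsto_incseq[OF abs[unfolded union] S] LIMSEQ_unique by blast
  then show "(?w has_sum L) {N. set_mset N \<subseteq> (\<Union>k. X k)}"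
    using has_sum_infsum[OF abs_summable_summable[OF abs]] by (simp add: union)
qed

section \<open>Euler's product\<close>

lemma convergent_prod_euler_power:
  fixes q :: "'a :: {real_normed_field, banach}"
  assumes "norm q < 1"
  shows "convergent_prod (\<lambda>n. (1 - q ^ Suc n) ^ r)"
proof -
  have "summable (\<lambda>n. norm (q ^ Suc n))"
    using assms by (simp add: norm_mult norm_power summable_geometric)
  then have "abs_convergent_prod (\<lambda>n. 1 - q ^ Suc n)"
    by (intro summable_imp_abs_convergent_prod) simp
  then show ?thesis
    by (intro convergent_prod_power abs_convergent_prod_imp_convergent_prod)
qed

text \<open>Stated over a general field to serve twice: complex \<open>q\<close> yields the value of
  the character sum, and the real number \<open>norm q\<close> the uniform bound behind absolute
  convergence.\<close>

lemma euler_power_LIMSEQ: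
  fixes q :: "'a :: {real_normed_field, banach}"
  assumes "norm q < 1"
  shows "(\<lambda>k. \<Prod>n\<le>k. 1 / (1 - q ^ Suc n) ^ r) \<longlonglongrightarrow> 1 / (\<Prod>n. (1 - q ^ Suc n) ^ r)"
proof -
  have "norm (q ^ Suc n) < 1" for n
    using assms by (simp only: norm_power power_less_one_iff norm_ge_zero) simp
  then have "(1 - q ^ Suc n) ^ r \<noteq> 0" for n
    by (metis norm_one order_less_irrefl power_eq_0_iff right_minus_eq)
  \<comment> \<open>A convergent product with no zero factor is non-zero, so reciprocals of the
    partial products converge too.\<close>
  then have "(\<Prod>n. (1 - q ^ Suc n) ^ r) \<noteq> 0"
    by (rule prodinf_nonzero[OF convergent_prod_euler_power[OF assms]])
  from tendsto_divide[OF tendsto_const convergent_prod_LIMSEQ[OF convergent_prod_euler_power[OF assms]] this]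
  show ?thesis
    by (simp add: prod_dividef)
qed

section \<open>Fock monomials counted by degree\<close>

lemma UNIV_boson: "UNIV = {A1, A2, C}"
  using boson.exhaust by blast

text \<open>The eigenvalue of the oscillator part of \<open>-d\<close> on a monomial; all three
  bosons enter alike.\<close>

abbreviation degree :: "(boson \<times> nat) multiset \<Rightarrow> nat" where
  "degree N \<equiv> sum_mset (image_mset snd N)"

abbreviation creation_monomials :: "(boson \<times> nat) multiset set" where
  "creation_monomials \<equiv> {N. \<forall>(j, n)\<in>#N. n \<ge> 1}"

text \<open>A monomial is a multiset of pairs (boson, mode). Each mode occurs with three bosons,
  hence the cube.\<close>

lemma has_sum_degree:
  fixes q :: complex
  assumes "norm q < 1"
  shows "(\<lambda>N. q ^ degree N) abs_summable_on creation_monomials"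
    and "((\<lambda>N. q ^ degree N) has_sum 1 / (\<Prod>n. (1 - q ^ Suc n) ^ 3)) creation_monomials"
proof -
  \<comment> \<open>Modes start at 1: a mode 0 would have weight \<open>q ^ 0 = 1\<close>, outside
    the range of the geometric series.\<close>
  define X :: "nat \<Rightarrow> (boson \<times> nat) set" where "X k = UNIV \<times> Suc ` {..k}" for k
  have fin: "finite (UNIV :: boson set)" by (simp add: UNIV_boson)
  have prodX: "(\<Prod>x\<in>X k. 1 / (1 - t ^ snd x)) = (\<Prod>n\<le>k. 1 / (1 - t ^ Suc n) ^ 3)"
    for k and t :: "'t :: field"
  proof -
    have "(\<Prod>x\<in>X k. 1 / (1 - t ^ snd x))
        = (\<Prod>j\<in>(UNIV :: boson set). \<Prod>n\<in>Suc ` {..k}. 1 / (1 - t ^ n))"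
      unfolding X_def by (subst prod.cartesian_product) (simp add: case_prod_beta)
    also have "\<dots> = (\<Prod>n\<le>k. 1 / (1 - t ^ Suc n)) ^ 3"
      by (simp add: prod.reindex UNIV_boson power3_eq_cube mult.assoc)
    finally show ?thesis
      by (simp add: prod_power_distrib power_divide)
  qed
  have union: "{N. set_mset N \<subseteq> (\<Union>k. X k)} = creation_monomials"
  proof -
    have "x \<in> (\<Union>k. X k) \<longleftrightarrow> snd x \<ge> 1" for x
      unfolding X_def by (cases x; cases "snd x") auto
    then show ?thesis by (auto simp: subset_iff)
  qed
  have w: "prod_mset (image_mset (\<lambda>x. q ^ snd x) N) = q ^ degree N" for N :: "(boson \<times> nat) multiset"
    by (induction N) (auto simp: power_add)
  have incX: "incseq X" and finX: "\<And>k. finite (X k)"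
    using fin by (auto simp: X_def incseq_def)
  have small: "norm (q ^ snd x) < 1" if x: "x \<in> X k" for x k
  proof -
    obtain n where "snd x = Suc n" using x by (auto simp: X_def)
    then show ?thesis
      using assms by (simp only: norm_power power_less_one_iff norm_ge_zero) simp
  qed
  have "Bseq (\<lambda>k. \<Prod>n\<le>k. 1 / (1 - norm q ^ Suc n) ^ 3)"
    using euler_power_LIMSEQ[of "norm q" 3] assms
    by (intro convergent_imp_Bseq convergentI) auto
  then obtain b where b: "\<And>k. norm (\<Prod>n\<le>k. 1 / (1 - norm q ^ Suc n) ^ 3) \<le> b"
    by (rule BseqE) blast
  have bound: "(\<Prod>x\<in>X k. 1 / (1 - norm (q ^ snd x))) \<le> b" for k
    using b[of k] unfolding norm_power prodX real_norm_def by linarith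
  have lim: "(\<lambda>k. \<Prod>x\<in>X k. 1 / (1 - q ^ snd x)) \<longlonglongrightarrow> 1 / (\<Prod>n. (1 - q ^ Suc n) ^ 3)"
    unfolding prodX by (rule euler_power_LIMSEQ[OF assms])
  note sums = has_sum_prod_mset[of X "\<lambda>x. q ^ snd x" b, OF incX finX small bound lim, unfolded union w]
  show "(\<lambda>N. q ^ degree N) abs_summable_on creation_monomials"
    by (rule sums(1))
  show "((\<lambda>N. q ^ degree N) has_sum 1 / (\<Prod>n. (1 - q ^ Suc n) ^ 3)) creation_monomials"
    by (rule sums(2))
qed

section \<open>Gaussian sums over the integers\<close>

text \<open>Completing the square; the bound is the value at the vertex
  \<open>t = - s / (2 * r)\<close>.\<close>

lemma quadratic_le_vertex:
  fixes r s t :: real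
  assumes "r < 0"
  shows "r * t\<^sup>2 + s * t \<le> s\<^sup>2 / (- 4 * r)"
proof -
  have "r * t\<^sup>2 + s * t - s\<^sup>2 / (- 4 * r) = (2 * r * t + s)\<^sup>2 / (4 * r)"
    using assms by (simp add: field_simps power2_eq_square)
  also have "\<dots> \<le> 0"
    using assms by (intro divide_nonneg_neg) auto
  finally show ?thesis by simp
qed

text \<open>Comparison with a multiple of \<open>exp (- \<bar>i\<bar>)\<close>, which is geometric
  on each half of the integers.\<close>

lemma abs_summable_on_gaussian_int:
  fixes a b c :: complex
  assumes "Re a < 0"
  shows "(\<lambda>i::int. exp (a * of_int i ^ 2 + b * of_int i + c)) abs_summable_on UNIV"
proof -
  \<comment> \<open>The extra 1 in the slope is held in reserve: bounding the quadratic with slope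
    \<open>?s\<close> leaves exactly the decay \<open>- \<bar>i\<bar>\<close>.\<close>
  let ?r = "Re a" and ?s = "\<bar>Re b\<bar> + 1"
  let ?K = "exp (?s\<^sup>2 / (- 4 * ?r) + Re c)"
  have geom: "(\<lambda>n. exp (- real n)) summable_on UNIV"
  proof -
    have "summable (\<lambda>n. exp (- 1 :: real) ^ n)" by (rule summable_geometric) simp
    moreover have "exp (- real n) = exp (- 1) ^ n" for n
      using exp_of_nat_mult[of n "- 1 :: real"] by simp
    ultimately have "summable (\<lambda>n. exp (- real n))" by (simp only:)
    then show ?thesis by (rule summable_nonneg_imp_summable_on) simp
  qed
  have "(\<lambda>i::int. exp (- real_of_int \<bar>i\<bar>)) summable_on range int \<union> range (\<lambda>n. - int n)"
  proof (rule summable_on_union)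
    show "(\<lambda>i::int. exp (- real_of_int \<bar>i\<bar>)) summable_on range int"
      using geom by (subst summable_on_reindex) (auto simp: o_def)
    show "(\<lambda>i::int. exp (- real_of_int \<bar>i\<bar>)) summable_on range (\<lambda>n. - int n)"
      using geom by (subst summable_on_reindex) (auto simp: o_def inj_on_def)
  qed
  moreover have "range int \<union> range (\<lambda>n. - int n) = UNIV"
    by (auto intro: int_cases2)
  ultimately have "(\<lambda>i::int. ?K * exp (- real_of_int \<bar>i\<bar>)) summable_on UNIV"
    by (intro summable_on_cmult_right) simp
  then show ?thesis
  proof (rule Infinite_Sum.abs_summable_on_comparison_test')
    fix i :: int
    let ?t = "\<bar>real_of_int i\<bar>"
    have "?r * real_of_int i ^ 2 + ?s * ?t \<le> ?s\<^sup>2 / (- 4 * ?r)"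
      using quadratic_le_vertex[OF assms, of ?t ?s] by (simp only: power2_abs)
    moreover have "Re b * real_of_int i \<le> \<bar>Re b\<bar> * ?t"
      by (metis abs_ge_self abs_mult)
    moreover have "?s * ?t = \<bar>Re b\<bar> * ?t + ?t"
      by (simp add: algebra_simps)
    ultimately have "?r * real_of_int i ^ 2 + Re b * real_of_int i + Re c
        \<le> ?s\<^sup>2 / (- 4 * ?r) + Re c - ?t"
      by linarith
    then have "exp (?r * real_of_int i ^ 2 + Re b * real_of_int i + Re c) \<le> ?K * exp (- ?t)"
      by (simp flip: exp_add)
    moreover have "Re (a * of_int i ^ 2 + b * of_int i + c)
        = ?r * real_of_int i ^ 2 + Re b * real_of_int i + Re c"
      by (simp add: power2_eq_square)
    ultimately show "norm (exp (a * of_int i ^ 2 + b * of_int i + c)) \<le> ?K * exp (- real_of_int \<bar>i\<bar>)"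
      by simp
  qed
qed

section \<open>Exponentials and traces of diagonal operators\<close>

lemma exp_op_diagonal:
  assumes "\<And>v s. D v s = c s * v s"
  shows "exp_op l D v s = exp (l * c s) * v s"
proof -
  have "(D ^^ k) v s = c s ^ k * v s" for k
    by (induction k) (auto simp: assms)
  then have "exp_op l D v s = (\<Sum>k. ((l * c s) ^ k /\<^sub>R fact k) * v s)"
    unfolding exp_op_def by (simp add: scaleR_conv_of_real power_mult_distrib field_simps)
  also have "\<dots> = exp (l * c s) * v s"
    by (rule sums_unique[symmetric, OF sums_mult2[OF exp_converges]])
  finally show ?thesis .
qed

text \<open>A diagonal operator cannot enlarge supports, so it preserves the module, and its
  diagonal coefficients are its eigenvalues.\<close>

lemma has_trace_diagonal:
  assumes T: "\<And>v s. T v s = c s * v s" and t: "(c has_sum t) B"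
  shows "has_trace (module_on B) T t"
proof -
  have supp: "{s. T v s \<noteq> 0} \<subseteq> {s. v s \<noteq> 0}" for v
    by (auto simp: T)
  have "T v \<in> module_on B" if "v \<in> module_on B" for v
    using that finite_subset[OF supp[of v]] supp[of v] unfolding module_on_def by blast
  moreover have "{s. ket s \<in> module_on B} = B"
    by (auto simp: module_on_def ket_def)
  moreover have "(\<lambda>s. T (ket s) s) = c"
    by (simp add: fun_eq_iff T ket_def)
  ultimately show ?thesis
    using t unfolding has_trace_def by simp
qed

section \<open>Eigenvalues of the zero modes and of \<open>derivation\<close>\<close>

lemma osc_zero: "osc q j 0 v s = fst s j * v s"
  by (cases s) (simp add: osc_def)

lemma h1_diagonal: "h1 q v s = (fst s A1 + fst s A2) * v s"
  by (simp add: h1_def bigA1_def osc_zero algebra_simps)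

lemma h2_diagonal: "h2 q v s = (fst s A1 - fst s A2) * v s"
  by (simp add: h2_def bigA2_def osc_zero algebra_simps)

text \<open>Each coefficient of the image depends on a single coefficient of \<open>v\<close>;
  linearity of \<open>osc\<close> follows with no further case distinction.\<close>

lemma osc_point_eval: "\<exists>k t. \<forall>v. osc q j n v s = k * v t"
proof (cases s)
  case (Pair l N)
  consider "n = 0" | "n < 0" | "n > 0" by linarith
  then show ?thesis
  proof cases
    case 1
    then show ?thesis using osc_zero by blast
  next
    case 2
    have "osc q j n v s = (if (j, nat (- n)) \<in># N then 1 else 0) * v (l, N - {#(j, nat (- n))#})" for v
      using 2 by (simp add: Pair osc_def)
    then show ?thesis by blast
  next
    case 3
    have "osc q j n v s = boson_sign j * (qint q n)\<^sup>2 / of_int n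
        * of_nat (count N (j, nat n) + 1) * v (l, add_mset (j, nat n) N)" for v
      using 3 by (simp add: Pair osc_def)
    then show ?thesis by blast
  qed
qed

lemma osc_linear:
  "osc q j n (\<lambda>t. f t + g t) s = osc q j n f s + osc q j n g s"
  "osc q j n (\<lambda>t. f t - g t) s = osc q j n f s - osc q j n g s"
  "osc q j n (\<lambda>t. c * f t) s = c * osc q j n f s"
proof -
  obtain k t where "osc q j n v s = k * v t" for v
    using osc_point_eval by blast
  then show
    "osc q j n (\<lambda>t. f t + g t) s = osc q j n f s + osc q j n g s"
    "osc q j n (\<lambda>t. f t - g t) s = osc q j n f s - osc q j n g s"
    "osc q j n (\<lambda>t. c * f t) s = c * osc q j n f s"
    by (simp_all add: algebra_simps)
qed

lemma osc_number:
  assumes "m > 0"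
  shows "osc q j (- m) (osc q j m v) s
    = boson_sign j * (qint q m)\<^sup>2 / of_int m * of_nat (count (snd s) (j, nat m)) * v s"
proof (cases s)
  case (Pair l N)
  show ?thesis
  proof (cases "(j, nat m) \<in># N")
    case True
    \<comment> \<open>The copy removed by the creation mode offsets the \<open>+ 1\<close> in the
      annihilation mode, leaving the occupation number.\<close>
    then have "count (N - {#(j, nat m)#}) (j, nat m) + 1 = count N (j, nat m)"
      by (metis Suc_eq_plus1 count_add_mset insert_DiffM)
    then show ?thesis
      using assms True unfolding Pair osc_def
      by (simp flip: of_nat_Suc)
  next
    case False
    then show ?thesis
      using assms unfolding Pair osc_def by (simp add: count_eq_zero_iff[THEN iffD2])
  qed
qed

text \<open>Equality of \<open>q powi k\<close> and \<open>q powi (- k)\<close> would give a square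
  equal to 1, against \<open>norm q < 1\<close>.\<close>

lemma qint_nonzero:
  assumes "norm q < 1" "q \<noteq> 0" "m > 0"
  shows "qint q m \<noteq> 0"
proof -
  have pw: "norm (q powi k) < 1" if "k > 0" for k
    using that assms(1) by (simp add: power_int_def norm_power power_less_one_iff)
  have "q powi k \<noteq> q powi (- k)" if "k > 0" for k
  proof
    assume "q powi k = q powi (- k)"
    then have "q powi k * q powi k = q powi (k + - k)"
      using assms by (subst power_int_add) auto
    then have "q powi k * q powi k = 1" by simp
    moreover have "norm (q powi k * q powi k) < 1"
      using mult_strict_mono[OF pw[OF that] pw[OF that]] by (simp add: norm_mult)
    ultimately show False by simp
  qed
  \<comment> \<open>The instance 1 handles the denominator \<open>q - inverse q\<close>; were it
    zero, the quotient would be 0.\<close>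
  from this[of m] this[of 1] show ?thesis
    using assms(3) by (simp add: qint_def)
qed

text \<open>A difference of squares. It lets the denominator in \<open>derivation\<close> cancel the
  factor built into \<open>bigA2\<close>.\<close>

lemma qint_double:
  assumes "q \<noteq> 0"
  shows "qint q (2 * m) = (q powi m + q powi (- m)) * qint q m"
proof -
  have "q powi (k + k) = q powi k * q powi k" for k
    using assms by (intro power_int_add) simp
  from this[of m] this[of "- m"] show ?thesis
    unfolding qint_def by (simp only: mult_2 minus_add_distrib square_diff_square_factored times_divide_eq_right)
qed

text \<open>The \<open>a\<^sup>1 a\<^sup>2\<close> cross terms cancel, so every mode contributes through number operators only.\<close>

lemma derivation_mode:
  assumes q: "norm q < 1" "q \<noteq> 0" and m: "m > 0"
  shows "of_int m ^ 2 / (qint q m * qint q (2 * m)) *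
      (bigA1 q (- m) (bigA2 q m v) s + bigA2 q (- m) (bigA1 q m v) s
        + qint q (2 * m) / qint q m * osc q C (- m) (osc q C m v) s)
    = of_int m * (\<Sum>j\<in>UNIV. of_nat (count (snd s) (j, nat m))) * v s"
proof -
  let ?p = "q powi m + q powi (- m)"
  have nz: "qint q m \<noteq> 0" "?p * qint q m \<noteq> 0"
    using qint_nonzero[OF q, of m] qint_nonzero[OF q, of "2 * m"] m qint_double[OF q(2), of m]
    by auto
  have "bigA1 q (- m) (bigA2 q m v) s + bigA2 q (- m) (bigA1 q m v) s
      = ?p * (osc q A1 (- m) (osc q A1 m v) s - osc q A2 (- m) (osc q A2 m v) s)"
    unfolding bigA1_def bigA2_def osc_linear by (simp add: field_simps)
  then have A: "bigA1 q (- m) (bigA2 q m v) s + bigA2 q (- m) (bigA1 q m v) s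
      = ?p * ((qint q m)\<^sup>2 / of_int m * of_nat (count (snd s) (A1, nat m)) * v s
          + (qint q m)\<^sup>2 / of_int m * of_nat (count (snd s) (A2, nat m)) * v s)"
    using m by (simp add: osc_number boson_sign_def)
  have alg: "M\<^sup>2 / (k * (p * k)) * (p * (k\<^sup>2 / M * a * u + k\<^sup>2 / M * b * u) + p * k / k * (k\<^sup>2 / M * c * u))
      = M * (a + (b + c)) * u"
    if "k \<noteq> 0" "p \<noteq> 0" "M \<noteq> 0" for M k p a b c u :: complex
    using that by (simp add: field_simps power2_eq_square)
  show ?thesis
    unfolding A qint_double[OF q(2)] osc_number[OF m]
    using alg[of "qint q m" ?p "of_int m"] nz m by (simp add: UNIV_boson boson_sign_def)
qed

text \<open>Adding \<open>(j, n)\<close> to the multiset changes only the term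
  \<open>m = int n\<close>, by \<open>n\<close>.\<close>

lemma has_sum_mode_count:
  "((\<lambda>m. of_int m * (\<Sum>j\<in>UNIV. of_nat (count N (j, nat m)))) has_sum (of_nat (degree N) :: complex))
     {1::int..}"
proof (induction N)
  case empty
  show ?case by simp
next
  case (add x N)
  obtain j n where x: "x = (j, n)" by (cases x)
  have "((\<lambda>m. if m = int n then of_int m else 0) has_sum (of_nat n :: complex)) {1::int..}"
  \<comment> \<open>For \<open>n = 0\<close> the index range misses the mode, in agreement with its
    zero contribution to \<open>degree\<close>.\<close>
  proof (cases "n = 0")
    case True
    then show ?thesis by (auto intro!: has_sum_0)
  next
    case False
    then have "((\<lambda>m. if m = int n then of_int m else 0) has_sum (of_nat n :: complex)) {int n}
      \<longleftrightarrow> ?thesis"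
      by (intro has_sum_cong_neutral) auto
    moreover have "((\<lambda>m. if m = int n then of_int m else 0) has_sum (of_nat n :: complex)) {int n}"
      by (rule has_sum_finiteI) auto
    ultimately show ?thesis by blast
  qed
  from has_sum_add[OF this add.IH] have
    "((\<lambda>m. (if m = int n then of_int m else 0)
        + of_int m * (\<Sum>j\<in>UNIV. of_nat (count N (j, nat m))))
      has_sum (of_nat (degree (add_mset x N)) :: complex)) {1::int..}"
    by (simp add: x)
  also have "?this \<longleftrightarrow> ?case"
  proof (rule has_sum_cong)
    fix m :: int
    assume "m \<in> {1..}"
    then show "(if m = int n then of_int m else 0)
        + of_int m * (\<Sum>j\<in>UNIV. of_nat (count N (j, nat m)))
      = (of_int m * (\<Sum>j\<in>UNIV. of_nat (count (add_mset x N) (j, nat m))) :: complex)"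
      by (cases j) (auto simp: x UNIV_boson algebra_simps)
  qed
  finally show ?case .
qed

lemma derivation_diagonal:
  assumes q: "norm q < 1" "q \<noteq> 0"
  shows "derivation q v s = - (of_nat (degree (snd s))
    + 1 / 2 * ((fst s A1 + fst s A2) * (fst s A1 - fst s A2) + fst s C * (fst s C + 1))) * v s"
proof -
  have "(\<Sum>\<^sub>\<infinity>m\<in>{1::int..}. of_int m ^ 2 / (qint q m * qint q (2 * m)) *
        (bigA1 q (- m) (bigA2 q m v) s + bigA2 q (- m) (bigA1 q m v) s
          + qint q (2 * m) / qint q m * osc q C (- m) (osc q C m v) s))
      = (\<Sum>\<^sub>\<infinity>m\<in>{1::int..}. of_int m * (\<Sum>j\<in>UNIV. of_nat (count (snd s) (j, nat m))) * v s)"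
    by (rule infsum_cong) (use derivation_mode[OF q] in auto)
  also have "\<dots> = of_nat (degree (snd s)) * v s"
    by (rule infsumI[OF has_sum_cmult_left[OF has_sum_mode_count]])
  finally show ?thesis
    unfolding derivation_def
    by (simp add: osc_zero h1_diagonal[unfolded h1_def] h2_diagonal[unfolded h2_def] algebra_simps)
qed

section \<open>Summation over the Fock module\<close>

text \<open>Injectivity of \<open>w\<close> identifies the basis with pairs (shift \<open>i\<close>,
  multiset \<open>N\<close>), over which the eigenvalue factors.\<close>

lemma has_sum_fock_basis:
  fixes q :: complex
  assumes q: "norm q < 1" and w: "inj w" and g: "g abs_summable_on (UNIV :: int set)"
    and c: "\<And>i N. c (w i, N) = p * (g i * q ^ degree N)"
  shows "(c has_sum (p / (\<Prod>n. (1 - q ^ Suc n) ^ 3) * infsum g UNIV)) (\<Union>i. fock_basis (w i))"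
proof -
  have "(g has_sum infsum g UNIV) UNIV"
    by (rule has_sum_infsum[OF abs_summable_summable[OF g]])
  from has_sum_times_abs(2)[OF g this has_sum_degree[OF q]]
  have "((\<lambda>x. p * (case x of (i, N) \<Rightarrow> g i * q ^ degree N))
      has_sum p * (infsum g UNIV * (1 / (\<Prod>n. (1 - q ^ Suc n) ^ 3)))) (UNIV \<times> creation_monomials)"
    by (rule has_sum_cmult_right)
  also have "(\<lambda>x. p * (case x of (i, N) \<Rightarrow> g i * q ^ degree N)) = (\<lambda>x. c (map_prod w id x))"
    by (auto simp: c)
  finally have "((\<lambda>x. c (map_prod w id x)) has_sum (p / (\<Prod>n. (1 - q ^ Suc n) ^ 3) * infsum g UNIV))
      (UNIV \<times> creation_monomials)"
    by (simp add: mult_ac)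
  moreover have "bij_betw (map_prod w id) (UNIV \<times> creation_monomials) (\<Union>i. fock_basis (w i))"
    using w by (fastforce simp: bij_betw_def inj_on_def fock_basis_def image_iff)
  ultimately show ?thesis
    by (simp add: has_sum_reindex_bij_betw)
qed

theorem proposition3:
  fixes \<alpha> \<beta> q x y lq lx ly :: complex
  assumes "\<alpha> \<notin> \<int>"
    and "0 < norm q" and "norm q < 1" and "x \<noteq> 0" and "y \<noteq> 0"
    and "exp lq = q" and "exp lx = x" and "exp ly = y"
  shows "has_Ch (fock_module \<alpha> \<beta>) lq lx ly
           (bpow lq (1 / 2 * \<alpha> * (2 * \<alpha> - 2 * \<beta> + 1)) / (\<Prod>n. (1 - q ^ Suc n) ^ 3) *
             (\<Sum>\<^sub>\<infinity>i::int. bpow lq (1 / 2 * (of_int i ^ 2 + of_int i))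
               * bpow lx (- \<alpha>) * bpow ly (2 * \<beta> - \<alpha> + 2 * of_int i)))
       \<and> has_Sch (fock_module \<alpha> \<beta>) lq lx ly
           (bpow lq (1 / 2 * \<alpha> * (2 * \<alpha> - 2 * \<beta> + 1)) / (\<Prod>n. (1 - q ^ Suc n) ^ 3) *
             (\<Sum>\<^sub>\<infinity>i::int. exp (\<i> * of_real pi * (\<alpha> + of_int i))
               * bpow lq (1 / 2 * (of_int i ^ 2 + of_int i))
               * bpow lx (- \<alpha>) * bpow ly (2 * \<beta> - \<alpha> + 2 * of_int i)))"
proof -
  let ?w = "\<lambda>i::int. weight (\<beta> - \<alpha> + of_int i) (- \<beta> - of_int i) (\<alpha> + of_int i)"
  let ?p = "bpow lq (1 / 2 * \<alpha> * (2 * \<alpha> - 2 * \<beta> + 1))"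
  let ?g = "\<lambda>i::int. bpow lq (1 / 2 * (of_int i ^ 2 + of_int i)) * bpow lx (- \<alpha>)
    * bpow ly (2 * \<beta> - \<alpha> + 2 * of_int i)"
  let ?g' = "\<lambda>i::int. exp (\<i> * of_real pi * (\<alpha> + of_int i))
    * bpow lq (1 / 2 * (of_int i ^ 2 + of_int i)) * bpow lx (- \<alpha>)
    * bpow ly (2 * \<beta> - \<alpha> + 2 * of_int i)"
  let ?T = "exp_op (- lq) (derivation (exp lq)) \<circ> exp_op lx (h1 (exp lq)) \<circ> exp_op ly (h2 (exp lq))"
  let ?S = "exp_op (\<i> * of_real pi) (fermion_number (exp lq)) \<circ> exp_op (- lq) (derivation (exp lq))
    \<circ> exp_op lx (h1 (exp lq)) \<circ> exp_op ly (h2 (exp lq))"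
  \<comment> \<open>The eigenvalue of \<open>?T\<close>; the minus sign in \<open>- lq\<close>
    cancels that of \<open>derivation\<close>.\<close>
  define c :: "monomial \<Rightarrow> complex" where "c = (\<lambda>(l, N).
    exp (lq * (of_nat (degree N) + 1 / 2 * ((l A1 + l A2) * (l A1 - l A2) + l C * (l C + 1))))
      * exp (lx * (l A1 + l A2)) * exp (ly * (l A1 - l A2)))"
  have q: "norm (exp lq) < 1" "exp lq \<noteq> 0" using assms by auto
  then have lq: "Re lq < 0" by simp
  have T: "?T v s = c s * v s" for v s
    using exp_op_diagonal[of "derivation (exp lq)", OF derivation_diagonal[OF q]]
      exp_op_diagonal[of "h1 (exp lq)", OF h1_diagonal]
      exp_op_diagonal[of "h2 (exp lq)", OF h2_diagonal]
    by (cases s) (simp add: c_def algebra_simps)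
  have S: "?S v s = exp (\<i> * of_real pi * fst s C) * c s * v s" for v s
    using T[of v s] exp_op_diagonal[of "fermion_number (exp lq)" "\<lambda>s. fst s C"]
    by (simp add: fermion_number_def osc_zero)
  \<comment> \<open>At shift \<open>i\<close> the eigenvalues are \<open>- \<alpha>\<close> for
    \<open>h1\<close> and \<open>2 * \<beta> - \<alpha> + 2 * of_int i\<close> for
    \<open>h2\<close>. In the zero-mode energy the terms in \<open>\<alpha> * of_int i\<close>
    cancel, which separates the prefactor \<open>?p\<close> from the sum over
    \<open>i\<close>.\<close>
  have c: "c (?w i, N) = ?p * (?g i * q ^ degree N)" for i N
  proof -
    have "q ^ degree N = exp (lq * of_nat (degree N))"
      using assms by (metis exp_of_nat2_mult)
    then show ?thesis
      unfolding c_def bpow_def weight_def prod.case boson.case exp_add[symmetric]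
      by (simp only: exp_add[symmetric]) (rule arg_cong[where f = exp], simp add: field_simps power2_eq_square)
  qed
  \<comment> \<open>The \<open>C\<close> component \<open>\<alpha> + of_int i\<close> already
    determines \<open>i\<close>.\<close>
  have inj: "inj ?w"
    by (rule injI) (metis add_left_cancel boson.simps(9) of_int_eq_iff weight_def)
  have "?g i = exp (lq / 2 * of_int i ^ 2 + (lq / 2 + 2 * ly) * of_int i
      + (ly * (2 * \<beta> - \<alpha>) - lx * \<alpha>))" for i
    unfolding bpow_def by (simp add: field_simps flip: exp_add)
  then have g: "?g abs_summable_on UNIV"
    using lq by (simp only:) (rule abs_summable_on_gaussian_int, simp)
  \<comment> \<open>The sign changes only the linear and constant coefficients, so the leading one,
    \<open>lq / 2\<close>, still has negative real part.\<close>
  have "?g' i = exp (lq / 2 * of_int i ^ 2 + (lq / 2 + 2 * ly + \<i> * of_real pi) * of_int i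
      + (ly * (2 * \<beta> - \<alpha>) - lx * \<alpha> + \<i> * of_real pi * \<alpha>))" for i
    unfolding bpow_def by (simp add: field_simps flip: exp_add)
  then have g': "?g' abs_summable_on UNIV"
    using lq by (simp only:) (rule abs_summable_on_gaussian_int, simp)
  have c': "exp (\<i> * of_real pi * fst (?w i, N) C) * c (?w i, N) = ?p * (?g' i * q ^ degree N)" for i N
    unfolding c by (simp add: weight_def)
  show ?thesis
    unfolding has_Ch_def has_Sch_def fock_module_def
    using has_trace_diagonal[where T = ?T and c = c, OF T has_sum_fock_basis[OF assms(3) inj g c]]
      has_trace_diagonal[where T = ?S and c = "\<lambda>s. exp (\<i> * of_real pi * fst s C) * c s",
        OF S has_sum_fock_basis[OF assms(3) inj g' c']]
    by blast
qed

end
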